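(* Let $\ell\ge 2$. For every $0\le i\le \ell$, the bivariate generating function $P_i(z,q)$ of $[0,\dots,0,1,0,\dots,0]$-admissible colored partitions on $2\ell$ rows (with $k_i=1$ and $k_j=0$ for $j\neq i$) satisfies, as formal power series, $$P_i(z,q)=\sum_{n_1,n_2,\dots,n_{\ell}\ge 0} \frac{z^{N_1}q^{N_1^2+N_2^2+\cdots+N_{\ell}^2+N_{i+1}+N_{i+2}+\cdots+N_{\ell}}}{(q;q)_{n_1}(q;q)_{n_2}\cdots(q;q)_{n_{\ell}}},$$ where $N_m=n_m+n_{m+1}+\cdots+n_\ell$ (and the sum $N_{i+1}+\cdots+N_\ell$ is $0$ when $i=\ell$).
   Context: Notation: $(a;q)_n=\prod_{j=1}^n(1-aq^{j-1})$. Array on $2\ell$ rows. Rows are numbered $1,\dots,2\ell$ from top to bottom. Each odd-numbered row consists of the parts $1,3,5,\dots$ and each even-numbered row consists of the parts $2,4,6,\dots$; parts of equal size in different rows are regarded as distinct (differently colored). A colored partition is a finite multiset of parts of this array; its weight is the sum of the sizes of its parts and its number of parts is counted with multiplicity. The frequency of a part (a given size in a given row) is the number of times it occurs. Extended frequency array. Given nonnegative integers $k_0,\dots,k_\ell$, place in each row, at horizontal position $s$, the frequency of the part of size $s$ in that row. In addition put one extra entry at position $-1$ in every odd row and one extra entry at position $0$ in every even row, as follows: for odd $i$ with $1\le i\le \ell$, $k_i$ is at position $-1$ of row $i$; for even $i$ with $0<i\le \ell$, $k_i$ is at position $-1$ of row $2\ell-i+1$; $k_0$ is at position $0$ of row $2\ell$;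 the entry at position $0$ of every other even row is $0$ (a placeholder). Thus odd rows have positions $-1,1,3,5,\dots$ and even rows have positions $0,2,4,\dots$. A downward path is a choice of one entry in each row $1,\dots,2\ell$ such that the positions of the entries in any two consecutive rows differ by exactly $1$ (extra entries are allowed). Let $k=k_0+\cdots+k_\ell$. A colored partition is $[k_0,\dots,k_\ell]$-admissible if, for every downward path in its extended frequency array, the sum of the entries on the path is at most $k$. For $0\le i\le\ell$, let $F(i,j,n)$ be the number of colored partitions of weight $n$ with exactly $j$ parts that are $[k_0,\dots,k_\ell]$-admissible for $k_i=1$ and all other $k_m=0$ (so $k=1$), and let $P_i(z,q)=\sum_{n,j\ge0}F(i,j,n)z^jq^n$. *)

theory Defs
  imports "HOL-Analysis.Analysis"
begin

definition qpoch :: "'a::comm_ring_1 \<Rightarrow> 'a \<Rightarrow> nat \<Rightarrow> 'a" where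
  "qpoch a q n = (\<Prod>j=1..n. 1 - a * q ^ (j - 1))"

text \<open>A part is a pair \<open>(r, s)\<close>: the part of size \<open>s\<close> in row \<open>r\<close>.\<close>

definition array_parts :: "nat \<Rightarrow> (nat \<times> nat) set" where
  "array_parts l = {(r, s). r \<in> {1..2*l} \<and> s \<ge> 1 \<and> (odd s \<longleftrightarrow> odd r)}"

definition colored_partition :: "nat \<Rightarrow> (nat \<times> nat) multiset \<Rightarrow> bool" where
  "colored_partition l M \<longleftrightarrow> set_mset M \<subseteq> array_parts l"

definition weight :: "(nat \<times> nat) multiset \<Rightarrow> nat" where
  "weight M = (\<Sum>(r, s)\<in>#M. s)"

definition row_positions :: "nat \<Rightarrow> int set" where
  "row_positions r = {s. s \<ge> -1 \<and> (odd s \<longleftrightarrow> odd r)}"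

text \<open>
  The entry at position \<open>s\<close> of row \<open>r\<close> in the extended frequency array; it is meaningful only
  for \<open>r \<in> {1..2*l}\<close> and \<open>s \<in> row_positions r\<close>. An odd row \<open>r > l\<close> equals \<open>2*l - i + 1\<close> for the
  even index \<open>i = 2*l + 1 - r\<close>, which lies in \<open>{1..l}\<close>.
\<close>

definition ext_freq :: "nat \<Rightarrow> (nat \<Rightarrow> nat) \<Rightarrow> (nat \<times> nat) multiset \<Rightarrow> nat \<Rightarrow> int \<Rightarrow> nat" where
  "ext_freq l k M r s =
     (if s > 0 then count M (r, nat s)
      else if odd r then (if r \<le> l then k r else k (2*l + 1 - r))
      else if r = 2*l then k 0
      else 0)"

definition downward_path :: "nat \<Rightarrow> (nat \<Rightarrow> int) \<Rightarrow> bool" where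
  "downward_path l p \<longleftrightarrow>
     (\<forall>r\<in>{1..2*l}. p r \<in> row_positions r) \<and>
     (\<forall>r\<in>{1..<2*l}. \<bar>p (r + 1) - p r\<bar> = 1)"

definition admissible :: "nat \<Rightarrow> (nat \<Rightarrow> nat) \<Rightarrow> (nat \<times> nat) multiset \<Rightarrow> bool" where
  "admissible l k M \<longleftrightarrow> colored_partition l M \<and>
     (\<forall>p. downward_path l p \<longrightarrow> (\<Sum>r=1..2*l. ext_freq l k M r (p r)) \<le> (\<Sum>m=0..l. k m))"

definition unit_vec :: "nat \<Rightarrow> nat \<Rightarrow> nat" where
  "unit_vec i = (\<lambda>m. if m = i then 1 else 0)"

definition F :: "nat \<Rightarrow> nat \<Rightarrow> nat \<Rightarrow> nat \<Rightarrow> nat" where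
  "F l i j n = card {M. admissible l (unit_vec i) M \<and> size M = j \<and> weight M = n}"

text \<open>The set counted by \<open>F\<close> is finite, so \<open>card\<close> is its true cardinality.\<close>

lemma finite_F: "finite {M. admissible l k M \<and> size M = j \<and> weight M = n}"
proof (rule finite_subset)
  let ?A = "{1..2*l} \<times> {0..n}"
  show "{M. admissible l k M \<and> size M = j \<and> weight M = n} \<subseteq> mset ` {xs. set xs \<subseteq> ?A \<and> length xs = j}"
  proof
    fix M assume "M \<in> {M. admissible l k M \<and> size M = j \<and> weight M = n}"
    hence M: "set_mset M \<subseteq> array_parts l" "size M = j" "weight M = n"
      by (auto simp: admissible_def colored_partition_def)
    obtain xs where xs: "mset xs = M" using ex_mset by blast
    have "(r, s) \<in> ?A" if rs: "(r, s) \<in># M" for r s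
    proof -
      obtain M' where "M = add_mset (r, s) M'" using rs by (meson mset_add)
      hence "s \<le> weight M" by (simp add: weight_def)
      moreover have "r \<in> {1..2*l}" using M(1) rs by (auto simp: array_parts_def)
      ultimately show ?thesis using M(3) by simp
    qed
    hence "set xs \<subseteq> ?A" unfolding xs[symmetric] by auto
    moreover have "length xs = j" using M(2) xs by auto
    ultimately show "M \<in> mset ` {xs. set xs \<subseteq> ?A \<and> length xs = j}" using xs by blast
  qed
  show "finite (mset ` {xs. set xs \<subseteq> ?A \<and> length xs = j})"
    by (intro finite_imageI finite_lists_length_eq) simp
qed

text \<open>
  Bivariate formal power series are elements of \<open>rat fps fps\<close>: the outer variable is \<open>z\<close>, and the
  coefficient of each power of \<open>z\<close> is a formal power series in \<open>q\<close>.
\<close>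

definition P :: "nat \<Rightarrow> nat \<Rightarrow> rat fps fps" where
  "P l i = Abs_fps (\<lambda>j. Abs_fps (\<lambda>n. of_nat (F l i j n)))"

abbreviation var_z :: "rat fps fps" where
  "var_z \<equiv> fps_X"

abbreviation var_q :: "rat fps" where
  "var_q \<equiv> fps_X"

text \<open>For \<open>m = l + 1\<close> the sum is empty.\<close>

definition N :: "nat \<Rightarrow> (nat \<Rightarrow> nat) \<Rightarrow> nat \<Rightarrow> nat" where
  "N l ns m = (\<Sum>r=m..l. ns r)"

end

theory Submission
  imports Defs
begin

text \<open>
  For total \<open>k = 1\<close>, two entries lie on a common downward path iff their horizontal distance is at
  most their row distance, so an admissible partition is a sequence of distinct parts
  \<open>(r\<^sub>1, s\<^sub>1), (r\<^sub>2, s\<^sub>2), \<dots>\<close> with \<open>s\<^sub>t\<^sub>+\<^sub>1 - s\<^sub>t = \<bar>r\<^sub>t\<^sub>+\<^sub>1 - r\<^sub>t\<bar> + 2 + 2 u\<^sub>t\<close>, starting from a virtual part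
  \<open>(\<rho>, -1)\<close>; here \<open>\<rho>\<close> is \<open>i\<close> or its mirror image \<open>2 l + 1 - i\<close>, whichever is odd
  (for \<open>i = 0\<close> the entry at \<open>(2 l, 0)\<close> has the same effect as one at \<open>(2 l + 1, -1)\<close>). Let \<open>Y\<^sub>\<rho>\<^sup>j\<close> be the
  coefficient of \<open>z\<^sup>j\<close> for an arbitrary start row \<open>\<rho>\<close>. Splitting off the first part gives
  \<open>(1 - x\<^sup>2) Y\<^sub>\<rho>\<^sup>j = q\<^sup>j\<^sup>-\<^sup>1 (\<Sum>r. x\<^bsup>\<bar>r - \<rho>\<bar> + 1\<^esup> Y\<^sub>r\<^sup>j\<^sup>-\<^sup>1)\<close> with \<open>x = q\<^sup>j\<close>. The kernel \<open>x\<^bsup>\<bar>r - \<rho>\<bar>\<^esup>\<close> is the Green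
  function of a second difference operator, whence the three-term recurrence
  \<open>x (Y\<^sub>\<rho>\<^sub>+\<^sub>1\<^sup>j + Y\<^sub>\<rho>\<^sub>-\<^sub>1\<^sup>j) = (1 + x\<^sup>2) Y\<^sub>\<rho>\<^sup>j - q\<^sup>2\<^sup>j\<^sup>-\<^sup>1 Y\<^sub>\<rho>\<^sup>j\<^sup>-\<^sup>1\<close> with the boundary conditions \<open>Y\<^sub>0\<^sup>j = x Y\<^sub>1\<^sup>j\<close>
  and (by reflection of the rows) \<open>Y\<^sub>l\<^sub>+\<^sub>1\<^sup>j = Y\<^sub>l\<^sup>j\<close>. The coefficients of the multisum satisfy the same
  recurrence and boundary conditions, which determine them by induction on \<open>j\<close>.
\<close>

subsection \<open>Admissibility for a single unit entry\<close>

text \<open>Support of the extended array for a unit vector: the inserted point is the position of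
  the one extra entry that equals 1.\<close>

definition entry_points :: "nat \<Rightarrow> nat \<Rightarrow> (nat \<times> nat) multiset \<Rightarrow> (nat \<times> int) set" where
  "entry_points l i M =
     insert (if i = 0 then (2 * l, 0) else if odd i then (i, -1) else (2 * l + 1 - i, -1))
       (map_prod id int ` set_mset M)"

definition spacelike :: "nat \<times> int \<Rightarrow> nat \<times> int \<Rightarrow> bool" where
  "spacelike x y \<longleftrightarrow> \<bar>int (fst x) - int (fst y)\<bar> < \<bar>snd x - snd y\<bar>"

lemma entry_points_range:
  assumes "i \<le> l" "l \<ge> 1" "colored_partition l M" "(r, s) \<in> entry_points l i M"
  shows "r \<in> {1..2*l} \<and> s \<in> row_positions r"
  using assms
  by (fastforce simp: entry_points_def row_positions_def colored_partition_def array_parts_def split: if_splits)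

lemma ext_freq_unit_vec:
  assumes "i \<le> l" "l \<ge> 1" "r \<in> {1..2*l}" "s \<in> row_positions r"
  shows "ext_freq l (unit_vec i) M r s =
    (if s > 0 then count M (r, nat s) else if (r, s) \<in> entry_points l i {#} then 1 else 0)"
proof (cases "s > 0")
  case False
  then have "s = (if odd r then - 1 else 0)"
    using assms(4) unfolding row_positions_def by auto presburger+
  then show ?thesis
    using assms(1-3) False by (auto simp: ext_freq_def unit_vec_def entry_points_def)
qed (simp add: ext_freq_def)

lemma ext_freq_pos_iff:
  assumes "i \<le> l" "l \<ge> 1" "r \<in> {1..2*l}" "s \<in> row_positions r" "colored_partition l M"
  shows "ext_freq l (unit_vec i) M r s > 0 \<longleftrightarrow> (r, s) \<in> entry_points l i M"
proof -
  have "x \<in># M \<Longrightarrow> snd x > 0" for x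
    using assms(5) by (auto simp: colored_partition_def array_parts_def)
  then have "(r, s) \<in> map_prod id int ` set_mset M \<longleftrightarrow> s > 0 \<and> (r, nat s) \<in># M"
    by (force simp: image_iff)
  then have "(r, s) \<in> entry_points l i M \<longleftrightarrow> (r, s) \<in> entry_points l i {#} \<or> s > 0 \<and> (r, nat s) \<in># M"
    unfolding entry_points_def by simp
  moreover have "(r, s) \<notin> entry_points l i {#}" if "s > 0"
    using that by (auto simp: entry_points_def)
  ultimately show ?thesis
    unfolding ext_freq_unit_vec[OF assms(1-4)] by (cases "s > 0") auto
qed

lemma sum_unit_vec: "i \<le> l \<Longrightarrow> (\<Sum>m=0..l. unit_vec i m) = 1"
  by (simp add: unit_vec_def)

lemma downward_path_dist:
  assumes "downward_path l p" "1 \<le> r" "r \<le> r'" "r' \<le> 2*l"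
  shows "\<bar>p r' - p r\<bar> \<le> int r' - int r"
  using assms(3,4)
proof (induction r' rule: dec_induct)
  case (step m)
  then have "\<bar>p (m + 1) - p m\<bar> = 1"
    using assms(1,2) by (simp add: downward_path_def)
  then show ?case using step by simp
qed simp

text \<open>The lower of the two upward rays leaving the two points; as both have the parity of the
  row, it still makes unit steps where the rays cross.\<close>

lemma downward_path_through:
  assumes "s \<in> row_positions r" "s' \<in> row_positions r'" "\<not> spacelike (r, s) (r', s') \<or> (r, s) = (r', s')"
  obtains p where "downward_path l p" "p r = s" "p r' = s'"
proof
  let ?p = "\<lambda>x. min (s + \<bar>int x - int r\<bar>) (s' + \<bar>int x - int r'\<bar>)"
  have par: "even (s - int r)" "even (s' - int r')" and ge: "s \<ge> -1" "s' \<ge> -1"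
    using assms(1,2) by (auto simp: row_positions_def)
  show "downward_path l ?p"
    unfolding downward_path_def
  proof (intro conjI ballI)
    fix x
    show "?p x \<in> row_positions x"
      using par ge unfolding row_positions_def by (auto simp: min_def abs_if) 
    show "\<bar>?p (x + 1) - ?p x\<bar> = 1"
    proof -
      define a b a' b' where "a = s + \<bar>int x - int r\<bar>" "b = s' + \<bar>int x - int r'\<bar>"
        "a' = s + \<bar>int (x + 1) - int r\<bar>" "b' = s' + \<bar>int (x + 1) - int r'\<bar>"
      note defs = this
      have "a' = a + 1 \<or> a' = a - 1" "b' = b + 1 \<or> b' = b - 1"
        unfolding defs by linarith+
      moreover have "even (a - int x)" "even (b - int x)"
        using par unfolding defs by presburger+
      then have "a = b \<or> a + 2 \<le> b \<or> b + 2 \<le> a"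
        by presburger
      ultimately have "\<bar>min a' b' - min a b\<bar> = 1"
        by (elim disjE) (simp_all add: min_def)
      then show ?thesis unfolding defs .
    qed
  qed
  show "?p r = s" "?p r' = s'"
    using assms(3) by (auto simp: spacelike_def)
qed

lemma sum_le_oneI:
  fixes f :: "'a \<Rightarrow> nat"
  assumes "finite A" "\<And>x. x \<in> A \<Longrightarrow> f x \<le> 1"
    and "\<And>x y. x \<in> A \<Longrightarrow> y \<in> A \<Longrightarrow> f x > 0 \<Longrightarrow> f y > 0 \<Longrightarrow> x = y"
  shows "sum f A \<le> 1"
proof (cases "\<exists>x\<in>A. f x > 0")
  case True
  then obtain x where x: "x \<in> A" "f x > 0" by blast
  then have "sum f A = sum f {x}"
    using assms by (intro sum.mono_neutral_right) auto
  then show ?thesis using assms(2) x by simp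
qed simp

text \<open>The bound on a path is 1, so admissibility forbids a part of frequency 2 and two nonzero
  entries on one path. By \<open>downward_path_through\<close> and
  \<open>downward_path_dist\<close>, two distinct entries share a path exactly when they are not
  \<open>spacelike\<close>.\<close>

lemma admissible_iff_spacelike:
  assumes il: "i \<le> l" "l \<ge> 1"
  shows "admissible l (unit_vec i) M \<longleftrightarrow> colored_partition l M \<and> (\<forall>x. count M x \<le> 1) \<and>
    pairwise spacelike (entry_points l i M)"
proof (intro iffI conjI)
  assume adm: "admissible l (unit_vec i) M"
  then show col: "colored_partition l M" by (simp add: admissible_def)
  note range = entry_points_range[OF il col] and pos = ext_freq_pos_iff[OF il _ _ col]
  have path: "(\<Sum>r=1..2*l. ext_freq l (unit_vec i) M r (p r)) \<le> 1" if "downward_path l p" for p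
    using adm that unfolding admissible_def sum_unit_vec[OF il(1)] by blast
  show "\<forall>x. count M x \<le> 1"
  proof
    fix x :: "nat \<times> nat"
    obtain r s where x: "x = (r, s)" by force
    show "count M x \<le> 1"
    proof (cases "x \<in># M")
      case True
      then have x': "(r, int s) \<in> entry_points l i M" "s > 0"
        using col by (force simp: entry_points_def x colored_partition_def array_parts_def)+
      obtain p where p: "downward_path l p" "p r = int s"
        using downward_path_through range[OF x'(1)] by metis
      have "count M x = ext_freq l (unit_vec i) M r (p r)"
        using x' by (simp add: p x ext_freq_def)
      also have "\<dots> \<le> (\<Sum>r=1..2*l. ext_freq l (unit_vec i) M r (p r))"
        using range[OF x'(1)] by (intro member_le_sum) auto
      finally show ?thesis using path[OF p(1)] by simp
    qed (simp add: not_in_iff)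
  qed
  show "pairwise spacelike (entry_points l i M)"
  proof (rule pairwiseI, rule ccontr)
    fix x y
    assume xy: "x \<in> entry_points l i M" "y \<in> entry_points l i M" "x \<noteq> y" "\<not> spacelike x y"
    obtain r s r' s' where eq: "x = (r, s)" "y = (r', s')" by force
    note range' = range[OF xy(1)[unfolded eq]] range[OF xy(2)[unfolded eq]]
    have neq: "r \<noteq> r'"
      using xy by (auto simp: eq spacelike_def)
    obtain p where p: "downward_path l p" "p r = s" "p r' = s'"
      using downward_path_through range' xy(4) unfolding eq by metis
    have "ext_freq l (unit_vec i) M r (p r) > 0" "ext_freq l (unit_vec i) M r' (p r') > 0"
      using range' xy pos unfolding p eq by auto
    then have "2 \<le> (\<Sum>r\<in>{r, r'}. ext_freq l (unit_vec i) M r (p r))"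
      using neq by simp
    also have "\<dots> \<le> (\<Sum>r=1..2*l. ext_freq l (unit_vec i) M r (p r))"
      using range' by (intro sum_mono2) auto
    finally show False using path[OF p(1)] by simp
  qed
next
  assume "colored_partition l M \<and> (\<forall>x. count M x \<le> 1) \<and> pairwise spacelike (entry_points l i M)"
  then have col: "colored_partition l M" and cnt: "\<And>x. count M x \<le> 1"
    and pw: "pairwise spacelike (entry_points l i M)" by auto
  have "(\<Sum>r=1..2*l. ext_freq l (unit_vec i) M r (p r)) \<le> 1" if p: "downward_path l p" for p
  proof (rule sum_le_oneI)
    have pos: "p r \<in> row_positions r" if "r \<in> {1..2*l}" for r
      using p that by (simp add: downward_path_def)
    show "ext_freq l (unit_vec i) M r (p r) \<le> 1" if "r \<in> {1..2*l}" for r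
      using ext_freq_unit_vec[OF il that pos[OF that]] cnt by simp
    fix r r'
    assume r: "r \<in> {1..2*l}" "r' \<in> {1..2*l}"
      "ext_freq l (unit_vec i) M r (p r) > 0" "ext_freq l (unit_vec i) M r' (p r') > 0"
    then have "(r, p r) \<in> entry_points l i M" "(r', p r') \<in> entry_points l i M"
      using ext_freq_pos_iff[OF il _ _ col] pos by auto
    moreover have "\<not> spacelike (r, p r) (r', p r')"
      using downward_path_dist[OF p, of r r'] downward_path_dist[OF p, of r' r] r(1,2)
      by (cases "r \<le> r'") (auto simp: spacelike_def)
    ultimately show "r = r'"
      using pw by (auto simp: pairwise_def)
  qed simp
  then show "admissible l (unit_vec i) M"
    using col by (simp add: admissible_def sum_unit_vec[OF il(1)])
qed

section \<open>Admissibility as an order condition on parts\<close>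

text \<open>The absolute difference without leaving \<open>nat\<close>: at least one of the two
  truncated differences is 0.\<close>

definition gap :: "nat \<Rightarrow> nat \<Rightarrow> nat" where
  "gap r s = (r - s) + (s - r)"

text \<open>The oriented form of \<open>spacelike\<close>: two parts are spacelike iff one of them
  precedes the other.\<close>

definition precedes :: "nat \<times> nat \<Rightarrow> nat \<times> nat \<Rightarrow> bool" where
  "precedes x y \<longleftrightarrow> snd x + gap (fst y) (fst x) < snd y"

definition start_row :: "nat \<Rightarrow> nat \<Rightarrow> nat" where
  "start_row l i = (if odd i then i else 2 * l + 1 - i)"

lemma odd_start_row: "i \<le> l \<Longrightarrow> odd (start_row l i)"
  by (auto simp: start_row_def)

lemma admissible_iff_precedes:
  assumes il: "i \<le> l" "l \<ge> 1"
  shows "admissible l (unit_vec i) M \<longleftrightarrow> set_mset M \<subseteq> array_parts l \<and> (\<forall>x. count M x \<le> 1) \<and>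
    (\<forall>(r, s) \<in># M. gap r (start_row l i) < s) \<and> (\<forall>x\<in>#M. \<forall>y\<in>#M. x \<noteq> y \<longrightarrow> precedes x y \<or> precedes y x)"
proof (cases "set_mset M \<subseteq> array_parts l")
  case True
  define x0 :: "nat \<times> int" where
    "x0 = (if i = 0 then (2 * l, 0) else if odd i then (i, -1) else (2 * l + 1 - i, -1))"
  have x0: "spacelike (r, int s) x0 \<longleftrightarrow> gap r (start_row l i) < s"
    "spacelike x0 (r, int s) \<longleftrightarrow> gap r (start_row l i) < s"
    if "(r, s) \<in># M" for r s
  proof -
    have *: "odd s \<longleftrightarrow> odd r" "r \<ge> 1" "r \<le> 2 * l" "s \<ge> 1"
      using that True by (auto simp: array_parts_def)
    show "spacelike (r, int s) x0 \<longleftrightarrow> gap r (start_row l i) < s"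
    proof (cases "i = 0")
      case True
      then have "spacelike (r, int s) x0 \<longleftrightarrow> 2 * l - r < s" "gap r (start_row l i) = 2 * l + 1 - r"
        using * by (auto simp: spacelike_def x0_def gap_def start_row_def)
      \<comment> \<open>Parity lets the entry at \<open>(2 * l, 0)\<close> be traded for a virtual
        one at \<open>(2 * l + 1, -1)\<close>: \<open>2 * l - r < s\<close> already forces
        \<open>2 * l + 1 - r < s\<close>.\<close>
      moreover have "s \<noteq> 2 * l + 1 - r" using * by auto
      ultimately show ?thesis using *(3) by linarith
    next
      case False
      define \<rho> where "\<rho> = start_row l i"
      have "odd \<rho>" unfolding \<rho>_def using il(1) by (rule odd_start_row)
      \<comment> \<open>The distance from -1 to \<open>s\<close> is \<open>s + 1\<close>, so
        \<open>spacelike\<close> only says that the gap is at most \<open>s\<close>; parity excludes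
        equality.\<close>
      then have "int s \<noteq> \<bar>int r - int \<rho>\<bar>" using *(1) by presburger
      moreover have "x0 = (\<rho>, -1)" using False by (simp add: x0_def \<rho>_def start_row_def)
      ultimately show ?thesis
        by (auto simp: spacelike_def gap_def \<rho>_def[symmetric])
    qed
    then show "spacelike x0 (r, int s) \<longleftrightarrow> gap r (start_row l i) < s"
      by (simp add: spacelike_def abs_minus_commute)
  qed
  have neq: "(r, int s) \<noteq> x0" if "(r, s) \<in># M" for r s
    using that True by (auto simp: array_parts_def x0_def)
  have xy: "spacelike (map_prod id int x) (map_prod id int y) \<longleftrightarrow> precedes x y \<or> precedes y x" for x y
    by (auto simp: spacelike_def precedes_def gap_def)
  have inj: "map_prod id int x = map_prod id int y \<longleftrightarrow> x = y" for x y
    by (cases x; cases y) simp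
  have entries: "entry_points l i M = insert x0 (map_prod id int ` set_mset M)"
    by (simp add: entry_points_def x0_def)
  have "pairwise spacelike (entry_points l i M) \<longleftrightarrow> (\<forall>(r, s) \<in># M. gap r (start_row l i) < s) \<and>
    (\<forall>x\<in>#M. \<forall>y\<in>#M. x \<noteq> y \<longrightarrow> precedes x y \<or> precedes y x)"
  proof -
    have "pairwise spacelike (map_prod id int ` set_mset M) \<longleftrightarrow>
      (\<forall>x\<in>#M. \<forall>y\<in>#M. x \<noteq> y \<longrightarrow> precedes x y \<or> precedes y x)"
      by (simp add: pairwise_image pairwise_def xy inj)
    moreover have "(\<forall>y. y \<in> map_prod id int ` set_mset M \<and> y \<noteq> x0 \<longrightarrow> spacelike x0 y \<and> spacelike y x0) \<longleftrightarrow>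
      (\<forall>(r, s) \<in># M. gap r (start_row l i) < s)"
    proof -
      have "map_prod id int x \<noteq> x0"
        "spacelike (map_prod id int x) x0 \<longleftrightarrow> gap (fst x) (start_row l i) < snd x"
        "spacelike x0 (map_prod id int x) \<longleftrightarrow> gap (fst x) (start_row l i) < snd x" if "x \<in># M" for x
        using that neq x0 by (cases x; simp)+
      then show ?thesis
        by (simp add: imp_conjL case_prod_unfold del: split_paired_All flip: Ball_def)
    qed
    ultimately show ?thesis
      by (simp only: entries pairwise_insert conj_commute)
  qed
  then show ?thesis
    by (simp only: admissible_iff_spacelike[OF il] colored_partition_def conj_assoc)
qed (simp add: admissible_def colored_partition_def)

subsection \<open>Gap sequences\<close>

text \<open>A code stores for each part its row and half of its excess over the smallest position
  that the predecessor allows. The argument \<open>p\<close> is the predecessor's position plus 1,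
  so \<open>p = 0\<close> stands for the virtual part at -1.\<close>

fun decode :: "nat \<Rightarrow> nat \<Rightarrow> (nat \<times> nat) list \<Rightarrow> (nat \<times> nat) list" where
  "decode \<rho> p [] = []"
| "decode \<rho> p ((r, u) # xs) = (let s = p + gap r \<rho> + 1 + 2 * u in (r, s) # decode r (s + 1) xs)"

text \<open>Moving a part moves all later ones with it, so the head increment counts
  \<open>Suc (length xs)\<close> times; the summand \<open>length xs\<close> is the unit in
  \<open>s + 1\<close> handed on to each later part.\<close>

fun code_weight :: "nat \<Rightarrow> (nat \<times> nat) list \<Rightarrow> nat" where
  "code_weight \<rho> [] = 0"
| "code_weight \<rho> ((r, u) # xs) =
     Suc (length xs) * (gap r \<rho> + 1 + 2 * u) + length xs + code_weight r xs"

definition codes :: "nat \<Rightarrow> nat \<Rightarrow> (nat \<times> nat) list set" where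
  "codes l j = {xs. length xs = j \<and> set xs \<subseteq> {1..2*l} \<times> UNIV}"

lemma length_decode [simp]: "length (decode \<rho> p xs) = length xs"
  by (induction \<rho> p xs rule: decode.induct) (simp_all add: Let_def)

lemma sum_list_decode: "sum_list (map snd (decode \<rho> p xs)) = code_weight \<rho> xs + p * length xs"
  by (induction \<rho> p xs rule: decode.induct) (simp_all add: Let_def algebra_simps)

lemma decode_inject: "decode \<rho> p xs = decode \<rho> p ys \<Longrightarrow> xs = ys"
proof (induction \<rho> p xs arbitrary: ys rule: decode.induct)
  case (1 \<rho> p)
  then show ?case by (cases ys) (auto simp: Let_def)
next
  case (2 \<rho> p r u xs)
  then obtain v zs where ys: "ys = (r, v) # zs"
    by (cases ys) (auto simp: Let_def)
  with 2(2) 2(1)[OF refl, of zs] show ?case by (auto simp: Let_def)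
qed

text \<open>The image of \<open>decode\<close>, stated as admissibility delivers it: the start
  condition bears on every part and \<open>precedes\<close> on every pair, not only on
  neighbours.\<close>

definition spread :: "nat \<Rightarrow> nat \<Rightarrow> nat \<Rightarrow> (nat \<times> nat) list \<Rightarrow> bool" where
  "spread l \<rho> p ys \<longleftrightarrow> set ys \<subseteq> array_parts l \<and> (\<forall>(r, s)\<in>set ys. p + gap r \<rho> < s) \<and>
     sorted_wrt precedes ys"

lemma even_gap [simp]: "even (gap r s) \<longleftrightarrow> even (r + s)"
  unfolding gap_def by presburger

text \<open>By parity, \<open>precedes\<close> leaves room for one more unit.\<close>

lemma spread_Cons:
  assumes "odd (\<rho> + p)"
  shows "spread l \<rho> p ((r, s) # ys) \<longleftrightarrow>
    r \<in> {1..2*l} \<and> (\<exists>u. s = p + gap r \<rho> + 1 + 2 * u) \<and> spread l r (s + 1) ys"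
proof -
  have head: "(r, s) \<in> array_parts l \<and> p + gap r \<rho> < s \<longleftrightarrow>
      r \<in> {1..2*l} \<and> (\<exists>u. s = p + gap r \<rho> + 1 + 2 * u)" (is "?L \<longleftrightarrow> ?R")
  proof
    assume L: ?L
    then have "even (s - (p + gap r \<rho> + 1))"
      using assms by (auto simp: array_parts_def)
    then obtain u where "s - (p + gap r \<rho> + 1) = 2 * u" ..
    then have "s = p + gap r \<rho> + 1 + 2 * u" using L by (elim conjE) linarith
    then show ?R using L by (auto simp: array_parts_def)
  next
    assume ?R
    then show ?L using assms by (auto simp: array_parts_def)
  qed
  have rest: "precedes (r, s) (r', s') \<and> p + gap r' \<rho> < s' \<longleftrightarrow> s + 1 + gap r' r < s'"
    if "(r, s) \<in> array_parts l" "(r', s') \<in> array_parts l" "p + gap r \<rho> < s" for r' s'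
  proof -
    have "odd s' \<longleftrightarrow> odd r'" "odd s \<longleftrightarrow> odd r"
      using that by (auto simp: array_parts_def)
    then have "s' \<noteq> s + 1 + gap r' r"
      by (auto simp: gap_def)
    \<comment> \<open>By this triangle inequality, clearing the new head implies clearing the old
      start, so conditions on neighbours suffice.\<close>
    moreover have "gap r' \<rho> \<le> gap r' r + gap r \<rho>"
      by (simp add: gap_def)
    ultimately show ?thesis
      using that(3) by (auto simp: precedes_def)
  qed
  show ?thesis
    using head rest unfolding spread_def by (fastforce simp: subset_iff)
qed

text \<open>\<open>odd (\<rho> + p)\<close> says that the preceding part, at position
  \<open>p - 1\<close> of row \<open>\<rho>\<close>, has the parity of its row; this invariant
  passes on to \<open>r\<close> and \<open>s + 1\<close>.\<close>

lemma decode_image: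
  "odd (\<rho> + p) \<Longrightarrow> decode \<rho> p ` codes l j = {ys. length ys = j \<and> spread l \<rho> p ys}"
proof (induction j arbitrary: \<rho> p)
  case 0
  then show ?case by (auto simp: codes_def spread_def)
next
  case (Suc j)
  have "ys \<in> decode \<rho> p ` codes l (Suc j) \<longleftrightarrow> length ys = Suc j \<and> spread l \<rho> p ys" for ys
  proof (cases ys)
    case Nil
    then show ?thesis
      by (auto simp: codes_def dest!: arg_cong[where f = length])
  next
    case (Cons y zs)
    obtain r s where y: "y = (r, s)" by force
    have "ys \<in> decode \<rho> p ` codes l (Suc j) \<longleftrightarrow>
      (\<exists>u xs. r \<in> {1..2*l} \<and> xs \<in> codes l j \<and> ys = decode \<rho> p ((r, u) # xs))"
    proof
      assume "ys \<in> decode \<rho> p ` codes l (Suc j)"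
      then obtain x xs where "x # xs \<in> codes l (Suc j)" "ys = decode \<rho> p (x # xs)"
        by (auto simp: codes_def length_Suc_conv)
      then show "\<exists>u xs. r \<in> {1..2*l} \<and> xs \<in> codes l j \<and> ys = decode \<rho> p ((r, u) # xs)"
        by (cases x) (auto simp: Cons y codes_def Let_def)
    qed (fastforce simp: codes_def)
    also have "\<dots> \<longleftrightarrow> (\<exists>u. r \<in> {1..2*l} \<and> s = p + gap r \<rho> + 1 + 2 * u \<and> zs \<in> decode r (s + 1) ` codes l j)"
      by (auto simp: Cons y Let_def)
    also have "\<dots> \<longleftrightarrow> (\<exists>u. r \<in> {1..2*l} \<and> s = p + gap r \<rho> + 1 + 2 * u \<and> length zs = j \<and> spread l r (s + 1) zs)"
    proof -
      have "odd (r + (s + 1))" if "s = p + gap r \<rho> + 1 + 2 * u" for u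
        using that Suc.prems by (auto simp: gap_def)
      then show ?thesis using Suc.IH by blast
    qed
    also have "\<dots> \<longleftrightarrow> length ys = Suc j \<and> spread l \<rho> p ys"
      unfolding Cons y spread_Cons[OF Suc.prems] by auto
    finally show ?thesis .
  qed
  then show ?case by blast
qed

section \<open>Admissible multisets as sorted lists\<close>

text \<open>\<open>precedes\<close> forces a strictly larger size, so pairwise comparable distinct
  parts form a chain once they are sorted by size.\<close>

lemma mset_image_spread:
  "mset ` {ys. length ys = j \<and> spread l \<rho> 0 ys} =
    {M. size M = j \<and> set_mset M \<subseteq> array_parts l \<and> (\<forall>x. count M x \<le> 1) \<and>
      (\<forall>(r, s)\<in>#M. gap r \<rho> < s) \<and> (\<forall>x\<in>#M. \<forall>y\<in>#M. x \<noteq> y \<longrightarrow> precedes x y \<or> precedes y x)}"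
  (is "?L = ?R")
proof (intro equalityI subsetI)
  fix M assume "M \<in> ?L"
  then obtain ys where ys: "M = mset ys" "length ys = j" "spread l \<rho> 0 ys" by blast
  have sorted: "sorted_wrt precedes ys"
    using ys by (simp add: spread_def)
  have "x \<noteq> y \<Longrightarrow> precedes x y \<or> precedes y x" if "x \<in> set ys" "y \<in> set ys" for x y
    using that sorted by (induction ys) auto
  moreover have "distinct ys"
    using sorted by (induction ys) (auto simp: precedes_def)
  ultimately show "M \<in> ?R"
    using ys by (auto simp: spread_def distinct_count_atmost_1)
next
  fix M assume M: "M \<in> ?R"
  obtain ys where ys: "mset ys = M" "sorted (map snd ys)"
    using ex_mset[of M] by (metis mset_sort sorted_sort_key)
  have "distinct ys"
    using M by (simp add: distinct_count_atmost_1 ys(1)[symmetric]) (metis One_nat_def le_Suc_eq le_zero_eq count_mset_0_iff count_mset_gt_0)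
  have "sorted_wrt precedes ys"
    unfolding sorted_wrt_iff_nth_less
  proof (intro allI impI)
    fix a b assume ab: "a < b" "b < length ys"
    then have "snd (ys ! a) \<le> snd (ys ! b)"
      using ys(2) by (simp add: sorted_iff_nth_mono_less)
    have "ys ! a \<noteq> ys ! b"
      using \<open>distinct ys\<close> ab by (simp add: nth_eq_iff_index_eq)
    moreover have "ys ! a \<in># M" "ys ! b \<in># M"
      using ab by (auto simp flip: ys(1))
    ultimately have "precedes (ys ! a) (ys ! b) \<or> precedes (ys ! b) (ys ! a)"
      using M by blast
    moreover note \<open>snd (ys ! a) \<le> snd (ys ! b)\<close>
    ultimately show "precedes (ys ! a) (ys ! b)"
      by (auto simp: precedes_def)
  qed
  then have "ys \<in> {ys. length ys = j \<and> spread l \<rho> 0 ys}"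
    using M by (auto simp: spread_def ys(1)[symmetric])
  then show "M \<in> ?L" using ys(1) by blast
qed

lemma inj_on_mset_spread: "inj_on mset {ys. spread l \<rho> p ys}"
proof (rule inj_onI)
  fix ys zs assume asm: "ys \<in> {ys. spread l \<rho> p ys}" "zs \<in> {ys. spread l \<rho> p ys}" "mset ys = mset zs"
  have strict: "sorted_wrt (<) (map snd xs)" if "sorted_wrt precedes xs" for xs
    using that by (induction xs) (auto simp: precedes_def)
  have sorted: "sorted_wrt (<) (map snd ys)" "sorted_wrt (<) (map snd zs)"
    using asm strict by (auto simp: spread_def)
  have eq: "set ys = set zs"
    using asm(3) by (rule mset_eq_setD)
  have "inj_on snd (set ys \<union> set zs)"
    using sorted(1) by (simp add: eq[symmetric] strict_sorted_iff distinct_map)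
  then show "ys = zs"
    using sorted eq by (intro map_sorted_distinct_set_unique[of snd]) (auto simp: strict_sorted_iff)
qed

lemma weight_mset: "weight (mset ys) = sum_list (map snd ys)"
  by (simp add: weight_def case_prod_unfold flip: sum_mset_sum_list)

lemma card_codes:
  assumes "odd \<rho>"
  shows "card {M. size M = j \<and> set_mset M \<subseteq> array_parts l \<and> (\<forall>x. count M x \<le> 1) \<and>
      (\<forall>(r, s)\<in>#M. gap r \<rho> < s) \<and> (\<forall>x\<in>#M. \<forall>y\<in>#M. x \<noteq> y \<longrightarrow> precedes x y \<or> precedes y x) \<and> weight M = n}
    = card {xs \<in> codes l j. code_weight \<rho> xs = n}"
proof -
  define f where "f = (\<lambda>xs. mset (decode \<rho> 0 xs))"
  have im: "decode \<rho> 0 ` codes l j = {ys. length ys = j \<and> spread l \<rho> 0 ys}"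
    by (rule decode_image) (simp add: assms)
  have "inj_on mset (decode \<rho> 0 ` codes l j)"
    unfolding im by (rule inj_on_subset[OF inj_on_mset_spread]) auto
  then have inj: "inj_on f (codes l j)"
    using decode_inject unfolding f_def inj_on_def by blast
  have wt: "weight (f xs) = code_weight \<rho> xs" for xs
    by (simp add: f_def weight_mset sum_list_decode)
  have "f ` codes l j = mset ` {ys. length ys = j \<and> spread l \<rho> 0 ys}"
    unfolding f_def im[symmetric] by (simp add: image_image)
  then have "{M. size M = j \<and> set_mset M \<subseteq> array_parts l \<and> (\<forall>x. count M x \<le> 1) \<and>
      (\<forall>(r, s)\<in>#M. gap r \<rho> < s) \<and> (\<forall>x\<in>#M. \<forall>y\<in>#M. x \<noteq> y \<longrightarrow> precedes x y \<or> precedes y x) \<and> weight M = n}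
     = {M \<in> f ` codes l j. weight M = n}"
    unfolding mset_image_spread by auto
  also have "\<dots> = f ` {xs \<in> codes l j. code_weight \<rho> xs = n}"
    by (auto simp: wt)
  finally show ?thesis
    using card_image[OF inj_on_subset[OF inj]] by simp
qed

section \<open>Generating functions of gap sequences\<close>

text \<open>\<open>card\<close> of an infinite weight class is 0, hence the finiteness hypotheses in
  the additivity lemmas below.\<close>

definition gen_fun :: "('a \<Rightarrow> nat) \<Rightarrow> 'a set \<Rightarrow> rat fps" where
  "gen_fun w A = Abs_fps (\<lambda>n. of_nat (card {x \<in> A. w x = n}))"

lemma gen_fun_image:
  assumes "inj_on f A" "\<And>x. x \<in> A \<Longrightarrow> w (f x) = c + v x"
  shows "gen_fun w (f ` A) = var_q ^ c * gen_fun v A"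
proof (rule fps_ext)
  fix n
  have "{y \<in> f ` A. w y = n} = f ` {x \<in> A. c + v x = n}"
    using assms(2) by auto
  then have "card {y \<in> f ` A. w y = n} = card {x \<in> A. c + v x = n}"
    using card_image[OF inj_on_subset[OF assms(1)], of "{x \<in> A. c + v x = n}"] by auto
  moreover have "{x \<in> A. c + v x = n} = (if n < c then {} else {x \<in> A. v x = n - c})"
    by auto
  ultimately show "fps_nth (gen_fun w (f ` A)) n = fps_nth (var_q ^ c * gen_fun v A) n"
    by (simp add: gen_fun_def fps_X_power_mult_nth)
qed

lemma gen_fun_Un:
  assumes "A \<inter> B = {}" "\<And>n. finite {x \<in> A. w x = n}" "\<And>n. finite {x \<in> B. w x = n}"
  shows "gen_fun w (A \<union> B) = gen_fun w A + gen_fun w B"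
proof (rule fps_ext)
  fix n
  have "{x \<in> A \<union> B. w x = n} = {x \<in> A. w x = n} \<union> {x \<in> B. w x = n}"
    by auto
  then have "card {x \<in> A \<union> B. w x = n} = card {x \<in> A. w x = n} + card {x \<in> B. w x = n}"
    using assms by (simp add: card_Un_disjoint disjoint_iff)
  then show "fps_nth (gen_fun w (A \<union> B)) n = fps_nth (gen_fun w A + gen_fun w B) n"
    by (simp add: gen_fun_def)
qed

lemma gen_fun_UN:
  assumes "finite I" "disjoint_family_on A I" "\<And>i n. i \<in> I \<Longrightarrow> finite {x \<in> A i. w x = n}"
  shows "gen_fun w (\<Union>i\<in>I. A i) = (\<Sum>i\<in>I. gen_fun w (A i))"
proof (rule fps_ext)
  fix n
  have "{x \<in> \<Union>i\<in>I. A i. w x = n} = (\<Union>i\<in>I. {x \<in> A i. w x = n})"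
    by auto
  also have "card \<dots> = (\<Sum>i\<in>I. card {x \<in> A i. w x = n})"
    using assms by (intro card_UN_disjoint) (auto simp: disjoint_family_on_def disjoint_iff)
  finally show "fps_nth (gen_fun w (\<Union>i\<in>I. A i)) n = fps_nth (\<Sum>i\<in>I. gen_fun w (A i)) n"
    by (simp add: gen_fun_def fps_sum_nth)
qed

lemma le_code_weight: "(r, u) \<in> set xs \<Longrightarrow> u \<le> code_weight \<rho> xs"
  by (induction \<rho> xs rule: code_weight.induct) fastforce+

lemma finite_codes: "finite {xs \<in> codes l j. code_weight \<rho> xs = n}"
proof (rule finite_subset)
  show "{xs \<in> codes l j. code_weight \<rho> xs = n} \<subseteq> {xs. set xs \<subseteq> {1..2*l} \<times> {..n} \<and> length xs = j}"
    using le_code_weight by (fastforce simp: codes_def)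
qed (rule finite_lists_length_eq, simp)

lemma codes_Suc: "codes l (Suc j) = {(r, u) # xs | r u xs. r \<in> {1..2*l} \<and> xs \<in> codes l j}"
  by (auto simp: codes_def length_Suc_conv)

definition code_gf :: "nat \<Rightarrow> nat \<Rightarrow> nat \<Rightarrow> rat fps" where
  "code_gf l \<rho> j = gen_fun (code_weight \<rho>) (codes l j)"

lemma code_gf_0: "code_gf l \<rho> 0 = 1"
proof -
  have "{xs \<in> codes l 0. code_weight \<rho> xs = n} = (if n = 0 then {[]} else {})" for n
    by (auto simp: codes_def)
  then show ?thesis
    by (simp add: code_gf_def gen_fun_def fps_eq_iff)
qed

lemma one_minus_var_q_power_nonzero: "n > 0 \<Longrightarrow> 1 - var_q ^ n \<noteq> 0"
  by (metis fps_X_power_nth fps_one_nth fps_sub_nth fps_zero_nth diff_zero less_numeral_extra(3) one_neq_zero)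

text \<open>A code either has first excess 0, and is then a row followed by a shorter code, or
  arises from another code by raising that excess. Raising it moves all \<open>Suc j\<close> parts
  by 2, which gives the factor \<open>var_q ^ (2 * Suc j)\<close>.\<close>

lemma code_gf_Suc:
  "(1 - var_q ^ (2 * Suc j)) * code_gf l \<rho> (Suc j)
    = (\<Sum>r=1..2*l. var_q ^ (Suc j * (gap r \<rho> + 1) + j) * code_gf l r j)"
proof -
  define bump where "bump = (\<lambda>xs :: (nat \<times> nat) list. (fst (hd xs), Suc (snd (hd xs))) # tl xs)"
  define U where "U = (\<Union>r\<in>{1..2*l}. (#) (r, 0) ` codes l j)"
  have split: "codes l (Suc j) = U \<union> bump ` codes l (Suc j)"
  proof (intro equalityI subsetI)
    fix xs assume "xs \<in> codes l (Suc j)"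
    then obtain r u ys where xs: "xs = (r, u) # ys" "r \<in> {1..2*l}" "ys \<in> codes l j"
      by (auto simp: codes_Suc)
    show "xs \<in> U \<union> bump ` codes l (Suc j)"
    proof (cases u)
      case (Suc v)
      then have "xs = bump ((r, v) # ys)" "(r, v) # ys \<in> codes l (Suc j)"
        using xs by (auto simp: bump_def codes_Suc)
      then show ?thesis by blast
    qed (use xs in \<open>auto simp: U_def\<close>)
  qed (auto simp: U_def bump_def codes_Suc)
  have sub: "finite {xs \<in> A. code_weight \<rho> xs = n}" if "A \<subseteq> codes l (Suc j)" for A n
    using that by (intro finite_subset[OF _ finite_codes[of l "Suc j" \<rho> n]]) auto
  have sub': "U \<subseteq> codes l (Suc j)" "bump ` codes l (Suc j) \<subseteq> codes l (Suc j)"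
    by (subst split, rule Un_upper1, subst (2) split, rule Un_upper2)
  have "U \<inter> bump ` codes l (Suc j) = {}"
    by (auto simp: U_def bump_def)
  then have "code_gf l \<rho> (Suc j) = gen_fun (code_weight \<rho>) U + gen_fun (code_weight \<rho>) (bump ` codes l (Suc j))"
    unfolding code_gf_def by (subst split) (intro gen_fun_Un sub sub')
  also have "gen_fun (code_weight \<rho>) (bump ` codes l (Suc j)) = var_q ^ (2 * Suc j) * code_gf l \<rho> (Suc j)"
    unfolding code_gf_def
  proof (rule gen_fun_image)
    show "inj_on bump (codes l (Suc j))"
      by (auto simp: inj_on_def bump_def codes_Suc)
  qed (auto simp: bump_def codes_Suc, simp add: codes_def)
  also have "gen_fun (code_weight \<rho>) U = (\<Sum>r=1..2*l. gen_fun (code_weight \<rho>) ((#) (r, 0) ` codes l j))"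
    unfolding U_def
  proof (rule gen_fun_UN)
    show "finite {xs \<in> (#) (r, 0) ` codes l j. code_weight \<rho> xs = n}" if "r \<in> {1..2*l}" for r n
      using that by (intro sub) (auto simp: codes_Suc)
  qed (auto simp: disjoint_family_on_def)
  also have "\<dots> = (\<Sum>r=1..2*l. var_q ^ (Suc j * (gap r \<rho> + 1) + j) * code_gf l r j)"
    unfolding code_gf_def by (intro sum.cong refl gen_fun_image) (auto simp: codes_def)
  finally show ?thesis
    by (simp add: algebra_simps)
qed

text \<open>Turning the rows upside down permutes them and preserves \<open>gap\<close>. The bound
  on \<open>\<rho>\<close> admits the virtual rows 0 and \<open>2 * l + 1\<close>, which are
  exchanged.\<close>

lemma code_gf_reflect: "\<rho> \<le> 2 * l + 1 \<Longrightarrow> code_gf l (2 * l + 1 - \<rho>) j = code_gf l \<rho> j"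
proof (induction j arbitrary: \<rho>)
  case (Suc j)
  have "(1 - var_q ^ (2 * Suc j)) * code_gf l (2 * l + 1 - \<rho>) (Suc j)
      = (\<Sum>r=1..2*l. var_q ^ (Suc j * (gap (2 * l + 1 - r) (2 * l + 1 - \<rho>) + 1) + j) * code_gf l (2 * l + 1 - r) j)"
    unfolding code_gf_Suc
    by (rule sum.reindex_bij_witness[of _ "\<lambda>r. 2 * l + 1 - r" "\<lambda>r. 2 * l + 1 - r"]) auto
  also have "\<dots> = (\<Sum>r=1..2*l. var_q ^ (Suc j * (gap r \<rho> + 1) + j) * code_gf l r j)"
  proof (rule sum.cong)
    fix r assume "r \<in> {1..2*l}"
    then have "gap (2 * l + 1 - r) (2 * l + 1 - \<rho>) = gap r \<rho>"
      using Suc.prems by (auto simp: gap_def)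
    then show "var_q ^ (Suc j * (gap (2 * l + 1 - r) (2 * l + 1 - \<rho>) + 1) + j) * code_gf l (2 * l + 1 - r) j
        = var_q ^ (Suc j * (gap r \<rho> + 1) + j) * code_gf l r j"
      using Suc.IH[of r] \<open>r \<in> {1..2*l}\<close> by simp
  qed simp
  also have "\<dots> = (1 - var_q ^ (2 * Suc j)) * code_gf l \<rho> (Suc j)"
    by (rule code_gf_Suc[symmetric])
  finally show ?case
    using one_minus_var_q_power_nonzero[of "2 * Suc j"] by (simp del: power_Suc)
qed (simp add: code_gf_0)

subsection \<open>Recurrences of the multisum\<close>

lemma qpoch_Suc: "qpoch a q (Suc n) = qpoch a q n * (1 - a * q ^ n)"
  by (simp add: qpoch_def)

lemma qpoch_nth_0: "fps_nth (qpoch var_q var_q n) 0 = 1"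
  by (induction n) (simp_all add: qpoch_Suc, simp add: qpoch_def)

text \<open>A nonzero constant term makes the denominator a unit, so that division of power series
  is multiplication by the inverse.\<close>

lemma prod_qpoch_nth_0: "fps_nth (\<Prod>m\<in>A. qpoch var_q var_q (ns m)) 0 \<noteq> 0"
  by (induction A rule: infinite_finite_induct) (simp_all add: qpoch_nth_0)

text \<open>\<open>PiE\<close> fixes the values outside \<open>{1..l}\<close>, so that each tuple is
  counted once.\<close>

definition compositions :: "nat \<Rightarrow> nat \<Rightarrow> (nat \<Rightarrow> nat) set" where
  "compositions l j = {ns \<in> PiE {1..l} (\<lambda>_. UNIV). N l ns 1 = j}"

definition summand :: "nat \<Rightarrow> (nat \<Rightarrow> nat) \<Rightarrow> rat fps" where
  "summand l ns = var_q ^ (\<Sum>m=1..l. (N l ns m)\<^sup>2) / (\<Prod>m=1..l. qpoch var_q var_q (ns m))"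

text \<open>The linear exponent \<open>w\<close> is left free because the recurrence for
  \<open>tail l i\<close> passes through exponents of other forms.\<close>

definition multisum :: "nat \<Rightarrow> ((nat \<Rightarrow> nat) \<Rightarrow> nat) \<Rightarrow> nat \<Rightarrow> rat fps" where
  "multisum l w j = (\<Sum>ns\<in>compositions l j. var_q ^ w ns * summand l ns)"

definition tail :: "nat \<Rightarrow> nat \<Rightarrow> (nat \<Rightarrow> nat) \<Rightarrow> nat" where
  "tail l i ns = (\<Sum>m=i+1..l. N l ns m)"

definition incr :: "nat \<Rightarrow> (nat \<Rightarrow> nat) \<Rightarrow> nat \<Rightarrow> nat" where
  "incr m ns = ns(m := Suc (ns m))"

lemma N_ge: "r \<in> {1..l} \<Longrightarrow> ns r \<le> N l ns 1"
  unfolding N_def by (rule member_le_sum) auto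

lemma N_antimono: "m \<le> m' \<Longrightarrow> N l ns m' \<le> N l ns m"
  unfolding N_def by (rule sum_mono2) auto

lemma N_eq_add: "m \<le> l \<Longrightarrow> N l ns m = ns m + N l ns (Suc m)"
  unfolding N_def by (rule sum.atLeast_Suc_atMost)

lemma finite_compositions: "finite (compositions l j)"
proof (rule finite_subset)
  show "compositions l j \<subseteq> PiE {1..l} (\<lambda>_. {..j})"
  proof
    fix ns assume "ns \<in> compositions l j"
    then show "ns \<in> PiE {1..l} (\<lambda>_. {..j})"
      using N_ge[of _ l ns] by (simp add: compositions_def PiE_iff del: One_nat_def)
  qed
qed (auto intro: finite_PiE)

lemma N_incr: "m \<in> {1..l} \<Longrightarrow> N l (incr m ns) t = N l ns t + (if t \<le> m then 1 else 0)"
proof -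
  assume m: "m \<in> {1..l}"
  have "N l (incr m ns) t = (\<Sum>r=t..l. ns r + (if m = r then 1 else 0))"
    unfolding N_def incr_def by (rule sum.cong) auto
  also have "\<dots> = N l ns t + (if t \<le> m then 1 else 0)"
    using m by (simp add: sum.distrib N_def)
  finally show ?thesis .
qed

lemma sum_squares_incr:
  assumes "m \<in> {1..l}"
  shows "(\<Sum>t=1..l. (N l (incr m ns) t)\<^sup>2) = (\<Sum>t=1..l. (N l ns t)\<^sup>2) + 2 * (\<Sum>t=1..m. N l ns t) + m"
proof -
  have "(\<Sum>t=1..l. (N l (incr m ns) t)\<^sup>2)
      = (\<Sum>t=1..l. (N l ns t)\<^sup>2 + (if t \<in> {1..m} then 2 * N l ns t + 1 else 0))"
    by (rule sum.cong) (auto simp: N_incr[OF assms] power2_eq_square)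
  also have "\<dots> = (\<Sum>t=1..l. (N l ns t)\<^sup>2) + (\<Sum>t\<in>{1..l} \<inter> {1..m}. 2 * N l ns t + 1)"
    by (subst sum.inter_restrict) (simp_all only: finite_atLeastAtMost sum.distrib)
  also have "{1..l} \<inter> {1..m} = {1..m}"
    using assms by auto
  also have "(\<Sum>t=1..m. 2 * N l ns t + 1) = 2 * (\<Sum>t=1..m. N l ns t) + m"
    by (simp only: sum.distrib sum_distrib_left) simp
  finally show ?thesis by simp
qed

text \<open>Raising \<open>ns m\<close> raises \<open>N l ns t\<close> by 1 for each
  \<open>t \<le> m\<close> and adds one factor to the denominator.\<close>

lemma summand_incr:
  assumes "m \<in> {1..l}"
  shows "(1 - var_q ^ Suc (ns m)) * summand l (incr m ns)
       = var_q ^ (2 * (\<Sum>t=1..m. N l ns t) + m) * summand l ns"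
proof -
  let ?d = "\<lambda>ns. \<Prod>r=1..l. qpoch var_q var_q (ns r) :: rat fps"
  have "?d (incr m ns) = qpoch var_q var_q (Suc (ns m)) * (\<Prod>r\<in>{1..l}-{m}. qpoch var_q var_q (ns r))"
    using assms by (subst prod.remove[of _ m]) (auto simp: incr_def intro!: prod.cong)
  also have "\<dots> = (1 - var_q ^ Suc (ns m)) * ?d ns"
    using assms by (subst (2) prod.remove[of _ m]) (auto simp: qpoch_Suc algebra_simps)
  finally have d: "?d (incr m ns) = (1 - var_q ^ Suc (ns m)) * ?d ns" .
  define x :: "rat fps" where "x = 1 - var_q ^ Suc (ns m)"
  have x: "x * inverse x = 1"
    by (subst mult.commute, rule inverse_mult_eq_1) (simp add: x_def)
  have "x * summand l (incr m ns)
      = x * inverse x * (var_q ^ (2 * (\<Sum>t=1..m. N l ns t) + m) * (var_q ^ (\<Sum>t=1..l. (N l ns t)\<^sup>2) * inverse (?d ns)))"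
    unfolding summand_def sum_squares_incr[OF assms] fps_divide_unit[OF prod_qpoch_nth_0]
    unfolding d fps_inverse_mult x_def[symmetric] by (simp only: power_add mult_ac)
  then show ?thesis
    unfolding x summand_def fps_divide_unit[OF prod_qpoch_nth_0] by (simp add: x_def)
qed

lemma multisum_cong:
  "(\<And>ns. ns \<in> compositions l j \<Longrightarrow> w ns = w' ns) \<Longrightarrow> multisum l w j = multisum l w' j"
  unfolding multisum_def by (rule sum.cong) auto

lemma multisum_add: "multisum l (\<lambda>ns. c + w ns) j = var_q ^ c * multisum l w j"
  by (simp add: multisum_def power_add sum_distrib_left mult.assoc)

text \<open>This is \<open>(1 - q\<^sup>n) / (q; q)\<^sub>n = 1 / (q; q)\<^sub>n\<^sub>-\<^sub>1\<close> with \<open>n = ns m\<close>, followed by a shift of \<open>n\<close>.\<close>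

lemma multisum_diff:
  assumes m: "m \<in> {1..l}"
  shows "multisum l w (Suc j) - multisum l (\<lambda>ns. w ns + ns m) (Suc j)
       = multisum l (\<lambda>ns. w (incr m ns) + 2 * (\<Sum>t=1..m. N l ns t) + m) j"
proof -
  let ?C = "{ns \<in> compositions l (Suc j). ns m \<noteq> 0}"
  have bij: "bij_betw (incr m) (compositions l j) ?C"
  proof (rule bij_betw_byWitness[where f' = "\<lambda>ns. ns(m := ns m - 1)"])
    show "incr m ` compositions l j \<subseteq> ?C"
      using m N_incr[OF m] by (auto simp: compositions_def PiE_iff extensional_def incr_def)
    have "N l ns 1 = Suc (N l (ns(m := ns m - 1)) 1)" if "ns m \<noteq> 0" for ns
      using N_incr[OF m, of "ns(m := ns m - 1)" 1] m that by (simp add: incr_def)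
    then show "(\<lambda>ns. ns(m := ns m - 1)) ` ?C \<subseteq> compositions l j"
      using m by (fastforce simp: compositions_def PiE_iff extensional_def)
  qed (auto simp: incr_def)
  have "multisum l w (Suc j) - multisum l (\<lambda>ns. w ns + ns m) (Suc j)
      = (\<Sum>ns\<in>compositions l (Suc j). var_q ^ w ns * (1 - var_q ^ ns m) * summand l ns)"
    by (simp add: multisum_def power_add algebra_simps flip: sum_subtractf)
  \<comment> \<open>The factor \<open>1 - var_q ^ ns m\<close> vanishes for \<open>ns m = 0\<close>;
    the remaining tuples are the images under \<open>incr m\<close>.\<close>
  also have "\<dots> = (\<Sum>ns\<in>?C. var_q ^ w ns * (1 - var_q ^ ns m) * summand l ns)"
    by (rule sum.mono_neutral_right) (auto simp: finite_compositions)
  also have "\<dots> = (\<Sum>ns\<in>compositions l j. var_q ^ w (incr m ns) * ((1 - var_q ^ Suc (ns m)) * summand l (incr m ns)))"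
    by (subst sum.reindex_bij_betw[OF bij, symmetric]) (simp add: incr_def algebra_simps)
  also have "\<dots> = multisum l (\<lambda>ns. w (incr m ns) + 2 * (\<Sum>t=1..m. N l ns t) + m) j"
    unfolding summand_incr[OF m] by (simp add: multisum_def power_add algebra_simps)
  finally show ?thesis .
qed

lemma tail_incr: "m \<in> {1..i} \<Longrightarrow> i \<le> l \<Longrightarrow> tail l i (incr m ns) = tail l i ns"
  unfolding tail_def by (rule sum.cong) (auto simp: N_incr)

lemma tail_eq_add: "tail l i ns = N l ns (Suc i) + tail l (Suc i) ns"
proof (cases "i < l")
  case True
  then show ?thesis by (simp add: tail_def sum.atLeast_Suc_atMost[of "Suc i" l])
qed (simp add: tail_def N_def)

lemma multisum_tail_0: "multisum l (tail l 0) j = var_q ^ j * multisum l (tail l 1) j"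
  unfolding multisum_add[symmetric]
  by (rule multisum_cong) (simp add: compositions_def tail_eq_add[of l 0])

lemma multisum_tail_recurrence:
  assumes i: "1 \<le> i" "i \<le> l"
  shows "var_q ^ Suc j * (multisum l (tail l (Suc i)) (Suc j) + multisum l (tail l (i - 1)) (Suc j))
    = (1 + var_q ^ (2 * Suc j)) * multisum l (tail l i) (Suc j) - var_q ^ (2 * j + 1) * multisum l (tail l i) j"
proof -
  txt \<open>\<open>A\<close> interpolates between the terms with \<open>i\<close> and \<open>i + 1\<close>, and \<open>B\<close> between those with \<open>i\<close> and
    \<open>i - 1\<close>; their increments agree except for the first one of \<open>A\<close>, which gives the last term.\<close>
  define A where "A m = multisum l (\<lambda>ns. N l ns 1 - N l ns m + tail l i ns) (Suc j)" for m
  define B where "B m = multisum l (\<lambda>ns. N l ns 1 + N l ns m + tail l i ns) (Suc j)" for m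
  \<comment> \<open>\<open>incr m\<close> raises \<open>N l ns 1\<close> and \<open>N l ns m\<close>
    alike, so their difference in the exponent stays. In \<open>B_diff\<close> it raises
    \<open>N l ns 1\<close> but not \<open>N l ns (Suc m)\<close>, whence the
    \<open>+ 1\<close>.\<close>
  have A_diff: "A m - A (Suc m) =
      multisum l (\<lambda>ns. N l ns 1 - N l ns m + tail l i ns + 2 * (\<Sum>t=1..m. N l ns t) + m) j"
    if m: "m \<in> {1..i}" for m
  proof -
    have ml: "m \<in> {1..l}" using m i by auto
    have "A (Suc m) = multisum l (\<lambda>ns. N l ns 1 - N l ns m + tail l i ns + ns m) (Suc j)"
      unfolding A_def
    proof (rule multisum_cong)
      fix ns
      have "N l ns m = ns m + N l ns (Suc m)" "N l ns m \<le> N l ns 1"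
        using ml by (auto intro: N_eq_add N_antimono)
      then show "N l ns 1 - N l ns (Suc m) + tail l i ns = N l ns 1 - N l ns m + tail l i ns + ns m"
        by simp
    qed
    then show ?thesis
      using multisum_diff[OF ml, of "\<lambda>ns. N l ns 1 - N l ns m + tail l i ns" j] ml
      by (simp add: A_def N_incr[OF ml] tail_incr[OF m i(2)])
  qed
  have B_diff: "B (Suc m) - B m =
      multisum l (\<lambda>ns. N l ns 1 + 1 + N l ns (Suc m) + tail l i ns + 2 * (\<Sum>t=1..m. N l ns t) + m) j"
    if m: "m \<in> {1..<i}" for m
  proof -
    have ml: "m \<in> {1..l}" "m \<in> {1..i}" using m i by auto
    have "B m = multisum l (\<lambda>ns. N l ns 1 + N l ns (Suc m) + tail l i ns + ns m) (Suc j)"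
      unfolding B_def using ml by (intro multisum_cong) (simp add: N_eq_add[of m])
    then show ?thesis
      using multisum_diff[OF ml(1), of "\<lambda>ns. N l ns 1 + N l ns (Suc m) + tail l i ns" j] ml
      by (simp add: B_def N_incr[OF ml(1)] tail_incr[OF ml(2) i(2)])
  qed
  \<comment> \<open>The last term \<open>2 * N l ns (Suc m)\<close> of the inner sum turns the
    subtracted \<open>N l ns (Suc m)\<close> into an added one.\<close>
  have step_diff: "A (Suc m) - A (Suc (Suc m)) = B (Suc m) - B m" if m: "m \<in> {1..<i}" for m
  proof -
    have Suc_m: "Suc m \<in> {1..i}" using m by auto
    show ?thesis
      unfolding A_diff[OF Suc_m] B_diff[OF m]
    proof (rule multisum_cong)
      fix ns
      have "N l ns (Suc m) \<le> N l ns 1"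
        by (rule N_antimono) simp
      then show "N l ns 1 - N l ns (Suc m) + tail l i ns + 2 * (\<Sum>t=1..Suc m. N l ns t) + Suc m
        = N l ns 1 + 1 + N l ns (Suc m) + tail l i ns + 2 * (\<Sum>t=1..m. N l ns t) + m"
        by simp
    qed
  qed
  \<comment> \<open>Telescoping of \<open>step_diff\<close>; it starts at \<open>A 2\<close> because
    the first increment \<open>A 1 - A 2\<close> has no partner in \<open>B\<close>.\<close>
  have "A 2 - A (Suc m) = B m - B 1" if "1 \<le> m" "m \<le> i" for m
    using that
  proof (induction m rule: dec_induct)
    case base
    then show ?case by (simp add: numeral_2_eq_2)
  next
    case (step m)
    have "A 2 - A (Suc (Suc m)) = (A 2 - A (Suc m)) + (A (Suc m) - A (Suc (Suc m)))"
      by simp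
    also have "\<dots> = (B m - B 1) + (B (Suc m) - B m)"
      using step step_diff[of m] by simp
    finally show ?case by simp
  qed
  then have AB: "A 2 - A (Suc i) = B i - B 1"
    using i by simp
  have A1: "A 1 = multisum l (tail l i) (Suc j)"
    by (simp add: A_def)
  have A12: "A 1 - A 2 = var_q ^ (2 * j + 1) * multisum l (tail l i) j"
    using A_diff[of 1] i unfolding multisum_add[symmetric]
    by (simp add: numeral_2_eq_2) (intro multisum_cong, simp add: compositions_def)
  have B1: "B 1 = var_q ^ (2 * Suc j) * multisum l (tail l i) (Suc j)"
    unfolding multisum_add[symmetric] B_def by (rule multisum_cong) (simp add: compositions_def)
  have Bi: "B i = var_q ^ Suc j * multisum l (tail l (i - 1)) (Suc j)"
    unfolding multisum_add[symmetric] B_def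
  proof (rule multisum_cong)
    fix ns assume "ns \<in> compositions l (Suc j)"
    then show "N l ns 1 + N l ns i + tail l i ns = Suc j + tail l (i - 1) ns"
      using tail_eq_add[of l "i - 1" ns] i by (simp add: compositions_def)
  qed
  have Ai: "A (Suc i) = var_q ^ Suc j * multisum l (tail l (Suc i)) (Suc j)"
    unfolding multisum_add[symmetric] A_def 
  proof (rule multisum_cong)
    fix ns assume "ns \<in> compositions l (Suc j)"
    then show "N l ns 1 - N l ns (Suc i) + tail l i ns = Suc j + tail l (Suc i) ns"
      using N_antimono[of 1 "Suc i" l ns] by (simp add: compositions_def tail_eq_add[of l i])
  qed
  \<comment> \<open>After folding, the goal is
    \<open>A (Suc i) + B i = A 1 + B 1 - (A 1 - A 2)\<close>, a rearrangement of
    \<open>AB\<close>.\<close>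
  show ?thesis
    unfolding distrib_left distrib_right mult_1 Ai[symmetric] Bi[symmetric] B1[symmetric] A12[symmetric]
    unfolding A1[symmetric] using AB by (simp add: algebra_simps)
qed

lemma multisum_0: "multisum l (tail l i) 0 = 1"
proof -
  have "compositions l 0 = {\<lambda>m\<in>{1..l}. 0}"
    by (auto simp: compositions_def N_def PiE_iff extensional_def fun_eq_iff)
  moreover have "N l (\<lambda>m\<in>{1..l}. 0) m = 0" if "m \<ge> 1" for m
    using that by (simp add: N_def)
  ultimately show ?thesis
    by (simp add: multisum_def summand_def tail_def qpoch_def)
qed

subsection \<open>Comparison of the two sides\<close>

lemma code_gf_recurrence:
  assumes \<rho>: "1 \<le> \<rho>" "\<rho> \<le> 2 * l"
  shows "var_q ^ Suc j * (code_gf l (Suc \<rho>) (Suc j) + code_gf l (\<rho> - 1) (Suc j))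
    = (1 + var_q ^ (2 * Suc j)) * code_gf l \<rho> (Suc j) - var_q ^ (2 * j + 1) * code_gf l \<rho> j"
proof -
  define x where "x = var_q ^ Suc j"
  define c where "c = 1 - x\<^sup>2"
  define y where "y r = var_q ^ j * code_gf l r j" for r
  have x2: "var_q ^ (2 * Suc j) = x\<^sup>2"
    unfolding x_def power_mult[symmetric] by (simp add: mult.commute)
  have xj: "var_q ^ (2 * j + 1) = x * var_q ^ j"
    unfolding x_def power_add[symmetric] by (rule arg_cong[where f = "(^) var_q"]) simp
  have gf: "c * code_gf l \<sigma> (Suc j) = (\<Sum>r=1..2*l. x * x ^ gap r \<sigma> * y r)" for \<sigma>
    unfolding c_def x2[symmetric] code_gf_Suc y_def
    by (intro sum.cong) (simp_all only: x_def power_add power_mult power_one_right mult_ac)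
  \<comment> \<open>Off the diagonal the two neighbouring gaps are one above and one below
    \<open>gap r \<rho>\<close>; on it both are 1, and
    \<open>2 * x\<^sup>2 = 1 + x\<^sup>2 - c\<close> supplies the point source.\<close>
  have green: "x * (x ^ gap r (Suc \<rho>) + x ^ gap r (\<rho> - 1))
      = (1 + x\<^sup>2) * x ^ gap r \<rho> - (if r = \<rho> then c else 0)" for r
  proof -
    consider "r = \<rho>" | "gap r (\<rho> - 1) = Suc (gap r \<rho>)" "gap r \<rho> = Suc (gap r (Suc \<rho>))" "r \<noteq> \<rho>"
      | "gap r (Suc \<rho>) = Suc (gap r \<rho>)" "gap r \<rho> = Suc (gap r (\<rho> - 1))" "r \<noteq> \<rho>"
      using \<rho>(1) by (cases r \<rho> rule: linorder_cases) (auto simp: gap_def)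
    then show ?thesis
    proof cases
      case 1
      then show ?thesis
        using \<rho>(1) by (simp add: gap_def c_def power2_eq_square)
    qed (simp_all add: algebra_simps power2_eq_square)
  qed
  have "c * (x * (code_gf l (Suc \<rho>) (Suc j) + code_gf l (\<rho> - 1) (Suc j)))
      = x * (c * code_gf l (Suc \<rho>) (Suc j) + c * code_gf l (\<rho> - 1) (Suc j))"
    by (simp only: distrib_left mult_ac)
  also have "\<dots> = (\<Sum>r=1..2*l. x * (x * (x ^ gap r (Suc \<rho>) + x ^ gap r (\<rho> - 1))) * y r)"
    unfolding gf sum.distrib[symmetric] sum_distrib_left
    by (intro sum.cong) (simp_all only: distrib_left distrib_right mult_ac)
  also have "\<dots> = (\<Sum>r=1..2*l. (1 + x\<^sup>2) * (x * x ^ gap r \<rho> * y r) - (if r = \<rho> then c * (x * y r) else 0))"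
    unfolding green by (intro sum.cong) (auto simp: algebra_simps)
  also have "\<dots> = (1 + x\<^sup>2) * (c * code_gf l \<rho> (Suc j)) - c * (x * y \<rho>)"
    unfolding gf using \<rho> by (simp add: sum_subtractf sum_distrib_left)
  also have "\<dots> = c * ((1 + x\<^sup>2) * code_gf l \<rho> (Suc j) - x * y \<rho>)"
    by (simp add: algebra_simps)
  finally have "x * (code_gf l (Suc \<rho>) (Suc j) + code_gf l (\<rho> - 1) (Suc j))
      = (1 + x\<^sup>2) * code_gf l \<rho> (Suc j) - x * y \<rho>"
    using one_minus_var_q_power_nonzero[of "2 * Suc j"] unfolding x2 c_def[symmetric] by simp
  then show ?thesis
    unfolding x2 xj y_def by (simp only: x_def mult.assoc)
qed

text \<open>Row 0 lies just outside the array, so every gap to it exceeds the gap to row 1 by one,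
  and each term of \<open>code_gf_Suc\<close> gains the factor \<open>var_q ^ j\<close>.\<close>

lemma code_gf_at_0: "code_gf l 0 j = var_q ^ j * code_gf l 1 j"
proof (cases j)
  case (Suc k)
  have "(1 - var_q ^ (2 * Suc k)) * code_gf l 0 (Suc k)
      = (\<Sum>r=1..2*l. var_q ^ Suc k * (var_q ^ (Suc k * (gap r 1 + 1) + k) * code_gf l r k))"
    unfolding code_gf_Suc
  proof (rule sum.cong)
    fix r assume "r \<in> {1..2*l}"
    then have "Suc k * (gap r 0 + 1) + k = Suc k + (Suc k * (gap r 1 + 1) + k)"
      by (auto simp: gap_def algebra_simps)
    then show "var_q ^ (Suc k * (gap r 0 + 1) + k) * code_gf l r k
        = var_q ^ Suc k * (var_q ^ (Suc k * (gap r 1 + 1) + k) * code_gf l r k)"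
      by (simp only: power_add mult.assoc)
  qed simp
  also have "\<dots> = (1 - var_q ^ (2 * Suc k)) * (var_q ^ Suc k * code_gf l 1 (Suc k))"
    unfolding sum_distrib_left[symmetric] code_gf_Suc[symmetric] by (rule mult.left_commute)
  finally show ?thesis
    using one_minus_var_q_power_nonzero[of "2 * Suc k"] unfolding Suc
    by (simp only: mult_cancel_left) simp
qed (simp add: code_gf_0)

text \<open>The left boundary condition propagates through the recurrence and leaves only geometric
  solutions, \<open>x * D (Suc i) = D i\<close>. At the right end this gives
  \<open>x * D l = D l\<close>, so \<open>D l = 0\<close>, and zero spreads back down.\<close>

lemma three_term_recurrence_zero:
  fixes D :: "nat \<Rightarrow> 'a::idom"
  assumes start: "D 0 = x * D 1" and "D (Suc l) = D l" "x \<noteq> 1"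
    and rec: "\<And>i. 1 \<le> i \<Longrightarrow> i \<le> l \<Longrightarrow> x * (D (Suc i) + D (i - 1)) = (1 + x\<^sup>2) * D i"
    and "i \<le> l"
  shows "D i = 0"
proof -
  have geom: "x * D (Suc i) = D i" if "i \<le> l" for i
    using that
  proof (induction i)
    case (Suc i)
    then have "x * D i = x\<^sup>2 * D (Suc i)"
      by (simp add: power2_eq_square mult.assoc)
    with rec[of "Suc i"] Suc.prems show ?case
      by (simp add: algebra_simps)
  qed (use start in simp)
  have "D l = 0"
    using geom[of l] assms(2,3) by simp
  show ?thesis
    using \<open>i \<le> l\<close>
  proof (induction i rule: inc_induct)
    case (step n)
    then show ?case using geom[of n] by simp
  qed (fact \<open>D l = 0\<close>)
qed

text \<open>The recurrence links neighbouring rows, so even \<open>i\<close> must be included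
  although partitions only produce odd start rows.\<close>

lemma code_gf_eq_multisum: "i \<le> l \<Longrightarrow> code_gf l i j = multisum l (tail l i) j"
proof (induction j arbitrary: i)
  case (Suc j)
  define x where "x = var_q ^ Suc j"
  define D where "D i = code_gf l i (Suc j) - multisum l (tail l i) (Suc j)" for i
  have "D i = 0"
  proof (rule three_term_recurrence_zero[of D x l i])
    show "D 0 = x * D 1"
      unfolding D_def x_def right_diff_distrib by (simp only: code_gf_at_0 multisum_tail_0)
    \<comment> \<open>Right boundary: for the multisum both tails are empty sums, and for
      \<open>code_gf\<close> the reflection exchanges rows \<open>l\<close> and
      \<open>l + 1\<close>.\<close>
    have "tail l (Suc l) = tail l l"
      by (simp add: tail_def fun_eq_iff)
    then show "D (Suc l) = D l"
      using code_gf_reflect[of l l "Suc j"] by (simp add: D_def)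
    show "x \<noteq> 1"
      using one_minus_var_q_power_nonzero[of "Suc j"] by (simp add: x_def del: power_Suc)
    show "i \<le> l" by fact
    fix i assume i: "1 \<le> i" "i \<le> l"
    have x2: "var_q ^ (2 * Suc j) = x\<^sup>2"
      unfolding x_def power_mult[symmetric] by (simp only: mult.commute)
    \<comment> \<open>By the induction hypothesis \<open>w\<close> is the inhomogeneous term of both
      recurrences, so it cancels in \<open>D\<close>.\<close>
    define w where "w = var_q ^ (2 * j + 1) * multisum l (tail l i) j"
    have gf: "x * (code_gf l (Suc i) (Suc j) + code_gf l (i - 1) (Suc j)) = (1 + x\<^sup>2) * code_gf l i (Suc j) - w"
      using code_gf_recurrence[of i l j] i unfolding Suc.IH[OF i(2)] x2 x_def[symmetric] w_def[symmetric] by simp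
    have ms: "x * (multisum l (tail l (Suc i)) (Suc j) + multisum l (tail l (i - 1)) (Suc j))
        = (1 + x\<^sup>2) * multisum l (tail l i) (Suc j) - w"
      using multisum_tail_recurrence[OF i, of j] unfolding x2 x_def[symmetric] w_def[symmetric] .
    have "x * (D (Suc i) + D (i - 1))
        = x * (code_gf l (Suc i) (Suc j) + code_gf l (i - 1) (Suc j))
        - x * (multisum l (tail l (Suc i)) (Suc j) + multisum l (tail l (i - 1)) (Suc j))"
      by (simp add: D_def algebra_simps)
    then show "x * (D (Suc i) + D (i - 1)) = (1 + x\<^sup>2) * D i"
      unfolding gf ms by (simp add: D_def algebra_simps)
  qed
  then show ?case by (simp add: D_def)
qed (simp add: code_gf_0 multisum_0)

section \<open>Coefficients of \<open>P\<close> and convergence of the multisum\<close>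

lemma P_nth:
  assumes "i \<le> l" "l \<ge> 1"
  shows "fps_nth (P l i) j = multisum l (tail l i) j"
proof -
  have "F l i j n = card {xs \<in> codes l j. code_weight (start_row l i) xs = n}" for n
    unfolding F_def card_codes[OF odd_start_row[OF assms(1)], symmetric] admissible_iff_precedes[OF assms]
    by (rule arg_cong[where f = card]) auto
  then have "fps_nth (P l i) j = code_gf l (start_row l i) j"
    by (simp add: P_def code_gf_def gen_fun_def)
  \<comment> \<open>For even \<open>i\<close> the start row is the mirror image of \<open>i\<close>,
    and the reflection returns it to \<open>i\<close>.\<close>
  also have "\<dots> = code_gf l i j"
    using code_gf_reflect[of i l j] assms(1) by (simp add: start_row_def)
  also have "\<dots> = multisum l (tail l i) j"
    using assms(1) by (rule code_gf_eq_multisum)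
  finally show ?thesis .
qed

theorem theorem1p5:
  fixes l i :: nat
  assumes "l \<ge> 2" and "i \<le> l"
  shows "((\<lambda>ns :: nat \<Rightarrow> nat.
             var_z ^ N l ns 1 *
             fps_const (var_q ^ ((\<Sum>m=1..l. (N l ns m)\<^sup>2) + (\<Sum>m=i+1..l. N l ns m)) /
                        (\<Prod>m=1..l. qpoch var_q var_q (ns m))))
          has_sum P l i) (PiE {1..l} (\<lambda>_. UNIV))"
proof -
  let ?A = "PiE {1..l} (\<lambda>_. UNIV) :: (nat \<Rightarrow> nat) set"
  let ?t = "\<lambda>ns. var_q ^ ((\<Sum>m=1..l. (N l ns m)\<^sup>2) + (\<Sum>m=i+1..l. N l ns m)) / (\<Prod>m=1..l. qpoch var_q var_q (ns m))"
  have t: "?t ns = var_q ^ tail l i ns * summand l ns" for ns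
    unfolding summand_def tail_def fps_divide_unit[OF prod_qpoch_nth_0] by (simp only: power_add mult_ac)
  show ?thesis
    unfolding has_sum_def
  proof (rule tendsto_fpsI)
    fix j
    \<comment> \<open>It suffices that each coefficient in \<open>var_z\<close> is eventually
      constant: the \<open>j\<close>-th one is settled once the finite index set contains
      \<open>compositions l j\<close>.\<close>
    have "fps_nth (\<Sum>ns\<in>Y. var_z ^ N l ns 1 * fps_const (?t ns)) j = fps_nth (P l i) j"
      if Y: "finite Y" "compositions l j \<subseteq> Y" "Y \<subseteq> ?A" for Y
    proof -
      have "fps_nth (\<Sum>ns\<in>Y. var_z ^ N l ns 1 * fps_const (?t ns)) j
          = (\<Sum>ns\<in>Y. if N l ns 1 = j then ?t ns else 0)"
        unfolding fps_sum_nth by (rule sum.cong) auto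
      also have "\<dots> = (\<Sum>ns\<in>compositions l j. ?t ns)"
        using Y by (intro sum.mono_neutral_cong_right) (auto simp: compositions_def)
      also have "\<dots> = fps_nth (P l i) j"
        using assms by (simp only: P_nth multisum_def t)
      finally show ?thesis .
    qed
    then show "\<forall>\<^sub>F Y in finite_subsets_at_top ?A.
        fps_nth (\<Sum>ns\<in>Y. var_z ^ N l ns 1 * fps_const (?t ns)) j = fps_nth (P l i) j"
      unfolding eventually_finite_subsets_at_top using finite_compositions[of l j]
      by (intro exI[of _ "compositions l j"]) (auto simp: compositions_def)
  qed
qed

end
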